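(* Let $\mathcal{X}\subset\mathbb{R}^n$ be closed, let $f,g_1,\dots,g_q:\mathbb{R}^n\to\mathbb{R}$, and let $x^*$ be a local minimizer of the problem $\min_{x\in\mathcal{X}} f(x)$ subject to $g_j(x)\le 0$, $j=1,\dots,q$. Assume that: (i) $f,g_1,\dots,g_q$ are locally Lipschitz and tangentially convex in a neighbourhood of $x^*$, and the contingent tangent cone $T_{\mathcal{X}}(x^* )$ is convex; (ii) $f$ and each $g_j$ are Clarke regular at $x^*$; (iii) the normal cone mapping $x\mapsto N_{\mathcal{X}}(x)$ is outer semicontinuous at $x^*$; (iv) $x^*$ is T-quasinormal. Then $x^*$ satisfies the enhanced T-KKT condition: there exist multipliers $\mu_j\ge 0$ ($j=1,\dots,q$) and vectors $\xi_f\in\partial_T f(x^* )$, $\xi_j\in\partial_T g_j(x^* )$ ($j=1,\dots,q$), $\eta\in N_{\mathcal{X}}(x^* )$ such that $$0=\xi_f+\sum_{j=1}^q\mu_j\xi_j+\eta\qquad\text{and}\qquad \mu_jg_j(x^* )=0,\quad j=1,\dots,q.$$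
   Context: For $h:\mathbb{R}^n\to\mathbb{R}\cup\{+\infty\}$ and $\bar x\in\operatorname{dom}h$, the directional derivative is $h'(\bar x;v):=\lim_{t\downarrow 0}\frac{h(\bar x+tv)-h(\bar x)}{t}$ whenever the limit exists. $h$ is tangentially convex at $\bar x$ if $h'(\bar x;v)$ exists and is finite for every $v\in\mathbb{R}^n$ and $v\mapsto h'(\bar x;v)$ is convex. The tangential subdifferential is $\partial_T h(\bar x):=\{\xi\in\mathbb{R}^n:\langle\xi,v\rangle\le h'(\bar x;v)\ \forall v\in\mathbb{R}^n\}$. A locally Lipschitz $h$ is Clarke regular at $\bar x$ if $h'(\bar x;v)$ exists and equals the Clarke directional derivative $h^\circ(\bar x;v)$ for all $v$. For nonempty $S\subset\mathbb{R}^n$ and $\bar x\in S$: the contingent tangent cone is $T_S(\bar x):=\{d:\exists t_k\downarrow 0,\ d_k\to d\text{ with }\bar x+t_kd_k\in S\}$; the Fréchet normal cone $\widehat N_S(x)$ (for $x\in S$) is $\{\xi:\limsup_{y\to x,\,y\in S,\,y\ne x}\langle\xi,y-x\rangle/\|y-x\|\le 0\}$; the limiting normal cone is $N_S(\bar x):=\{\xi:\exists x^k\to\bar x\ (x^k\in S),\ \xi^k\to\xi,\ \xi^k\in\widehat N_S(x^k)\}$. A multifunction $M$ is outer semicontinuous at $x^*$ if $x^k\to x^*$, $\xi^k\in M(x^k)$, $\xi^k\to\xi$ imply $\xi\in M(x^* )$. The feasible set is $C:=\{x\in\mathcal{X}:g_j(x)\le 0,\ j=1,\dots,q\}$. A feasible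 point $x^*$ is T-quasinormal if there is no nonzero $\mu\in\mathbb{R}_+^q$ such that $0\in\sum_{j=1}^q\mu_j\partial_T g_j(x^* )+N_{\mathcal{X}}(x^* )$ and there exists a sequence of infeasible points $x^k\to x^*$ with $\mu_jg_j(x^k)>0$ for all $k$ and all $j\in J:=\{j:\mu_j>0\}$. *)

theory Defs
  imports "HOL-Analysis.Analysis"
begin

definition locally_lipschitz_on :: "'a::metric_space set \<Rightarrow> ('a \<Rightarrow> real) \<Rightarrow> bool" where
  "locally_lipschitz_on U h \<longleftrightarrow> (\<forall>x\<in>U. \<exists>e>0. \<exists>L. L-lipschitz_on (ball x e) h)"

definition has_dir_deriv ::
    "('a::real_normed_vector \<Rightarrow> real) \<Rightarrow> 'a \<Rightarrow> 'a \<Rightarrow> real \<Rightarrow> bool" where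
  "has_dir_deriv h x v d \<longleftrightarrow> ((\<lambda>t. (h (x + t *\<^sub>R v) - h x) / t) \<longlongrightarrow> d) (at_right 0)"

text \<open>The value is unspecified when the limit does not exist as a real number.\<close>
definition dir_deriv :: "('a::real_normed_vector \<Rightarrow> real) \<Rightarrow> 'a \<Rightarrow> 'a \<Rightarrow> real" where
  "dir_deriv h x v = (THE d. has_dir_deriv h x v d)"

definition tangentially_convex_at :: "('a::real_normed_vector \<Rightarrow> real) \<Rightarrow> 'a \<Rightarrow> bool" where
  "tangentially_convex_at h x \<longleftrightarrow>
     (\<forall>v. \<exists>d. has_dir_deriv h x v d) \<and> convex_on UNIV (dir_deriv h x)"

definition tangential_subdiff :: "('a::real_inner \<Rightarrow> real) \<Rightarrow> 'a \<Rightarrow> 'a set" where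
  "tangential_subdiff h x = {\<xi>. \<forall>v. \<xi> \<bullet> v \<le> dir_deriv h x v}"

text \<open>The upper limit over \<open>y \<rightarrow> x\<close> and \<open>t \<down> 0\<close> jointly; the base point \<open>y = x\<close> is allowed.\<close>
definition clarke_deriv :: "('a::real_normed_vector \<Rightarrow> real) \<Rightarrow> 'a \<Rightarrow> 'a \<Rightarrow> ereal" where
  "clarke_deriv h x v =
     Limsup (nhds x \<times>\<^sub>F at_right 0) (\<lambda>(y, t). ereal ((h (y + t *\<^sub>R v) - h y) / t))"

definition clarke_regular_at :: "('a::real_normed_vector \<Rightarrow> real) \<Rightarrow> 'a \<Rightarrow> bool" where
  "clarke_regular_at h x \<longleftrightarrow>
     (\<exists>U. open U \<and> x \<in> U \<and> locally_lipschitz_on U h) \<and>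
     (\<forall>v. \<exists>d. has_dir_deriv h x v d \<and> ereal d = clarke_deriv h x v)"

definition contingent_cone :: "'a::real_normed_vector set \<Rightarrow> 'a \<Rightarrow> 'a set" where
  "contingent_cone S x =
     {d. \<exists>(t :: nat \<Rightarrow> real) (dk :: nat \<Rightarrow> 'a).
           (\<forall>k. t k > 0) \<and> t \<longlonglongrightarrow> 0 \<and> dk \<longlonglongrightarrow> d \<and> (\<forall>k. x + t k *\<^sub>R dk k \<in> S)}"

text \<open>Meant for \<open>x \<in> S\<close>. The filter \<open>at x within S\<close> excludes \<open>x\<close>; at an isolated
  point of \<open>S\<close> it is trivial, the upper limit is \<open>-\<infinity>\<close> and the cone is the whole space.\<close>
definition frechet_normal_cone :: "'a::real_inner set \<Rightarrow> 'a \<Rightarrow> 'a set" where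
  "frechet_normal_cone S x =
     {\<xi>. Limsup (at x within S) (\<lambda>y. ereal ((\<xi> \<bullet> (y - x)) / norm (y - x))) \<le> 0}"

text \<open>For closed \<open>S\<close> this is empty at every point outside \<open>S\<close>.\<close>
definition limiting_normal_cone :: "'a::real_inner set \<Rightarrow> 'a \<Rightarrow> 'a set" where
  "limiting_normal_cone S x =
     {\<xi>. \<exists>(xk :: nat \<Rightarrow> 'a) (\<xi>k :: nat \<Rightarrow> 'a).
           (\<forall>k. xk k \<in> S) \<and> xk \<longlonglongrightarrow> x \<and> \<xi>k \<longlonglongrightarrow> \<xi> \<and>
           (\<forall>k. \<xi>k k \<in> frechet_normal_cone S (xk k))}"

definition outer_semicontinuous_at ::
    "('a::topological_space \<Rightarrow> 'b::topological_space set) \<Rightarrow> 'a \<Rightarrow> bool" where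
  "outer_semicontinuous_at M x \<longleftrightarrow>
     (\<forall>(xk :: nat \<Rightarrow> 'a) (\<xi>k :: nat \<Rightarrow> 'b) \<xi>.
        xk \<longlonglongrightarrow> x \<longrightarrow> (\<forall>k. \<xi>k k \<in> M (xk k)) \<longrightarrow> \<xi>k \<longlonglongrightarrow> \<xi> \<longrightarrow> \<xi> \<in> M x)"

definition feasible_set :: "'a set \<Rightarrow> nat \<Rightarrow> (nat \<Rightarrow> 'a \<Rightarrow> real) \<Rightarrow> 'a set" where
  "feasible_set X q g = {x \<in> X. \<forall>j\<in>{1..q}. g j x \<le> 0}"

definition local_minimizer_on :: "'a::metric_space set \<Rightarrow> ('a \<Rightarrow> real) \<Rightarrow> 'a \<Rightarrow> bool" where
  "local_minimizer_on C f x \<longleftrightarrow> x \<in> C \<and> (\<exists>e>0. \<forall>y\<in>C \<inter> ball x e. f x \<le> f y)"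

text \<open>Sums of sets are Minkowski sums. Infeasible means outside the feasible set; the points
  \<open>xk k\<close> need not lie in \<open>X\<close>.\<close>
definition T_quasinormal ::
    "'a::real_inner set \<Rightarrow> nat \<Rightarrow> (nat \<Rightarrow> 'a \<Rightarrow> real) \<Rightarrow> 'a \<Rightarrow> bool" where
  "T_quasinormal X q g x \<longleftrightarrow>
     x \<in> feasible_set X q g \<and>
     \<not> (\<exists>\<mu> :: nat \<Rightarrow> real.
          (\<forall>j\<in>{1..q}. \<mu> j \<ge> 0) \<and> (\<exists>j\<in>{1..q}. \<mu> j \<noteq> 0) \<and>
          0 \<in> (\<Sum>j\<in>{1..q}. (\<lambda>\<xi>. \<mu> j *\<^sub>R \<xi>) ` tangential_subdiff (g j) x)
                + limiting_normal_cone X x \<and>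
          (\<exists>xk :: nat \<Rightarrow> 'a.
             (\<forall>k. xk k \<notin> feasible_set X q g) \<and> xk \<longlonglongrightarrow> x \<and>
             (\<forall>k. \<forall>j\<in>{j \<in> {1..q}. \<mu> j > 0}. \<mu> j * g j (xk k) > 0)))"

end

theory Submission
  imports Defs
begin

text \<open>The problem is penalised with the variable \<open>y\<close> of the functions separated from the variable
  \<open>z \<in> X\<close>: minimise
  \<open>f(y) + c (\<Sum>\<^sub>j g\<^sub>j\<^sup>+(y)\<^sup>2 + |y - z|\<^sup>2) + |y - x|\<^sup>2\<close>.
  Minimality in \<open>z\<close> makes \<open>2c (y - z)\<close> a Frechet normal to \<open>X\<close> at \<open>z\<close>. Minimality in \<open>y\<close> is
  unconstrained, so it only needs one-sided directional derivatives, with multipliers \<open>2c g\<^sub>j\<^sup>+(y)\<close>.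
  As \<open>c \<rightarrow> \<infinity>\<close> both variables tend to \<open>x\<close>. Dividing by one plus the sum of the multipliers and
  extracting a limit, where Clarke regularity gives the upper semicontinuity of the directional
  derivatives, yields a Fritz John condition. A vanishing multiplier of \<open>f\<close> would contradict
  T-quasinormality, the points \<open>y\<close> being the infeasible sequence. The stationarity inequality is
  finally split into tangential subgradients by separation.\<close>

section \<open>Directional derivatives and tangential subgradients\<close>

text \<open>Restricting \<open>h\<close> to the ray from \<open>x\<close> turns directional
  derivatives into right derivatives at 0, which makes the sum, product and chain rules
  available.\<close>

lemma has_dir_deriv_iff_field_derivative:
  "has_dir_deriv h x v d \<longleftrightarrow> ((\<lambda>t. h (x + t *\<^sub>R v)) has_field_derivative d) (at_right 0)"
  by (simp add: has_dir_deriv_def has_field_derivative_iff)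

lemma has_dir_deriv_unique:
  assumes "has_dir_deriv h x v d" "has_dir_deriv h x v d'"
  shows "d = d'"
  using assms unfolding has_dir_deriv_def
  by (rule tendsto_unique[rotated]) simp

lemma dir_deriv_eqI:
  assumes "has_dir_deriv h x v d"
  shows "dir_deriv h x v = d"
  unfolding dir_deriv_def
  by (rule the_equality) (rule assms, erule has_dir_deriv_unique[OF _ assms])

lemma has_dir_deriv_dir_deriv:
  assumes "tangentially_convex_at h x"
  shows "has_dir_deriv h x v (dir_deriv h x v)"
proof -
  obtain d where "has_dir_deriv h x v d"
    using assms unfolding tangentially_convex_at_def by blast
  then show ?thesis by (simp add: dir_deriv_eqI)
qed

lemma has_dir_deriv_scaleR:
  assumes "has_dir_deriv h x v d" and "a > 0"
  shows "has_dir_deriv h x (a *\<^sub>R v) (a * d)"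
proof -
  have "filterlim (\<lambda>t. a * t) (at_right 0) (at_right (0::real))"
    by (rule filterlim_times_pos[OF filterlim_ident assms(2)]) simp
  from filterlim_compose[OF assms(1)[unfolded has_dir_deriv_def] this]
  have "((\<lambda>t. a * ((h (x + (a * t) *\<^sub>R v) - h x) / (a * t))) \<longlongrightarrow> a * d) (at_right 0)"
    by (rule tendsto_mult_left)
  moreover have "a * ((h (x + (a * t) *\<^sub>R v) - h x) / (a * t))
      = (h (x + t *\<^sub>R a *\<^sub>R v) - h x) / t" for t
    using assms(2) by (simp add: mult.commute[of a])
  ultimately show ?thesis by (simp only: has_dir_deriv_def)
qed

lemma dir_deriv_zero: "dir_deriv h x 0 = 0"
  by (rule dir_deriv_eqI) (simp add: has_dir_deriv_def)

text \<open>Convexity at the midpoint of 2u and 2v; positive homogeneity then removes the factor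
  2.\<close>

lemma dir_deriv_subadditive:
  assumes "tangentially_convex_at h x"
  shows "dir_deriv h x (u + v) \<le> dir_deriv h x u + dir_deriv h x v"
proof -
  let ?p = "dir_deriv h x"
  have hom: "?p (a *\<^sub>R w) = a * ?p w" if "a > 0" for a w
    using has_dir_deriv_scaleR[OF has_dir_deriv_dir_deriv[OF assms] that] by (rule dir_deriv_eqI)
  have cvx: "convex_on UNIV ?p"
    using assms by (simp add: tangentially_convex_at_def)
  have "u + v = (1 - 1/2) *\<^sub>R (2 *\<^sub>R u) + (1/2) *\<^sub>R (2 *\<^sub>R v)" by simp
  also have "?p \<dots> \<le> (1 - 1/2) * ?p (2 *\<^sub>R u) + (1/2) * ?p (2 *\<^sub>R v)"
    by (rule convex_onD[OF cvx]) auto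
  also have "\<dots> = ?p u + ?p v"
    by (simp only: hom[of 2 u, simplified] hom[of 2 v, simplified]) simp
  finally show ?thesis .
qed

text \<open>Finite-dimensional Hahn-Banach: the sublinear function \<open>dir_deriv h x\<close> is
  the support function of the tangential subdifferential, with attained supremum. A hyperplane
  supporting the epigraph over \<open>v\<close> supplies the subgradient.\<close>

lemma tangential_subgradient_attaining:
  fixes h :: "'a::euclidean_space \<Rightarrow> real"
  assumes tc: "tangentially_convex_at h x"
  obtains \<xi> where "\<xi> \<in> tangential_subdiff h x" "\<xi> \<bullet> v = dir_deriv h x v"
proof -
  let ?p = "dir_deriv h x"
  \<comment> \<open>The strict epigraph, translated so that its boundary point over \<open>v\<close>
    becomes the origin. Being strict, it omits the origin and can be separated from it.\<close>
  define S where "S = {(u, r). ?p (v + u) - ?p v < r}"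
  have cvx: "convex_on UNIV ?p"
    using tc by (simp add: tangentially_convex_at_def)
  have "convex_on UNIV (\<lambda>u. ?p (v + u) - ?p v)"
  proof (rule convex_onI)
    fix t :: real and a b assume t: "0 < t" "t < 1"
    have eq: "v + ((1 - t) *\<^sub>R a + t *\<^sub>R b) = (1 - t) *\<^sub>R (v + a) + t *\<^sub>R (v + b)"
      by (simp add: algebra_simps)
    have "?p ((1 - t) *\<^sub>R (v + a) + t *\<^sub>R (v + b)) \<le> (1 - t) * ?p (v + a) + t * ?p (v + b)"
      using t by (intro convex_onD[OF cvx]) auto
    then show "?p (v + ((1 - t) *\<^sub>R a + t *\<^sub>R b)) - ?p v
        \<le> (1 - t) * (?p (v + a) - ?p v) + t * (?p (v + b) - ?p v)"
      unfolding eq by argo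
  qed simp
  then have "convex {(u, r). ?p (v + u) - ?p v < r}"
    unfolding convex_def
  proof (clarsimp)
    fix a b :: 'a and r s \<mu> \<nu> :: real
    assume cvx: "convex_on UNIV (\<lambda>u. ?p (v + u) - ?p v)"
      and lt: "?p (v + a) - ?p v < r" "?p (v + b) - ?p v < s"
      and \<mu>: "0 \<le> \<mu>" "0 \<le> \<nu>" "\<mu> + \<nu> = 1"
    have "?p (v + (\<mu> *\<^sub>R a + \<nu> *\<^sub>R b)) - ?p v
        \<le> \<mu> * (?p (v + a) - ?p v) + \<nu> * (?p (v + b) - ?p v)"
      using cvx \<mu> unfolding convex_on_def by blast
    \<comment> \<open>Only a positive weight keeps an inequality strict; if \<open>\<mu>\<close>
      vanishes, then \<open>\<nu>\<close> is 1 and carries the strictness.\<close>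
    also have "\<dots> < \<mu> * r + \<nu> * s"
    proof (cases "\<mu> = 0")
      case False
      then have "\<mu> * (?p (v + a) - ?p v) < \<mu> * r"
        using lt(1) \<mu>(1) by (intro mult_strict_left_mono) auto
      moreover have "\<nu> * (?p (v + b) - ?p v) \<le> \<nu> * s"
        using lt(2) \<mu>(2) by (intro mult_left_mono) auto
      ultimately show ?thesis by (rule add_less_le_mono)
    qed (use lt \<mu> in auto)
    finally show "?p (v + (\<mu> *\<^sub>R a + \<nu> *\<^sub>R b)) - ?p v < \<mu> * r + \<nu> * s" .
  qed
  then have "convex S" by (simp add: S_def)
  moreover have "0 \<notin> S" by (simp add: S_def zero_prod_def)
  ultimately have "\<exists>c. c \<noteq> 0 \<and> (\<forall>s\<in>S. 0 \<le> c \<bullet> s)"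
    by (rule separating_hyperplane_set_0)
  then obtain c where c: "c \<noteq> 0" "\<And>s. s \<in> S \<Longrightarrow> 0 \<le> c \<bullet> s"
    by blast
  obtain \<alpha> \<beta> where ab: "c = (\<alpha>, \<beta>)" by (cases c)
  have sep: "0 \<le> \<alpha> \<bullet> u + \<beta> * r" if "?p (v + u) - ?p v < r" for u r
    using c(2)[of "(u, r)"] that by (simp add: S_def ab)
  have "\<beta> \<ge> 0" using sep[of 0 1] by simp
  \<comment> \<open>The hyperplane is not vertical: \<open>?p\<close> is finite everywhere, so the
    epigraph has points over every \<open>u\<close>, in particular over
    \<open>- \<alpha>\<close>.\<close>
  moreover have "\<beta> \<noteq> 0"
  proof
    assume b0: "\<beta> = 0"
    have "0 \<le> \<alpha> \<bullet> (- \<alpha>)" using sep[of "- \<alpha>" "?p (v - \<alpha>) - ?p v + 1"] b0 by simp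
    then have "\<alpha> \<bullet> \<alpha> = 0" using inner_ge_zero[of \<alpha>] by simp
    then have "\<alpha> = 0" by simp
    with b0 c(1) ab show False by (simp add: zero_prod_def)
  qed
  ultimately have "\<beta> > 0" by simp
  define \<xi> where "\<xi> = - (1 / \<beta>) *\<^sub>R \<alpha>"
  have sub: "\<xi> \<bullet> u \<le> ?p (v + u) - ?p v" for u
  proof (rule field_le_epsilon)
    fix e :: real assume "e > 0"
    then have "0 \<le> \<alpha> \<bullet> u + \<beta> * (?p (v + u) - ?p v + e)" by (intro sep) simp
    then show "\<xi> \<bullet> u \<le> ?p (v + u) - ?p v + e"
      using \<open>\<beta> > 0\<close> by (simp add: \<xi>_def field_simps)
  qed
  \<comment> \<open>By subadditivity, a subgradient of \<open>?p\<close> at \<open>v\<close> is also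
    one at the origin.\<close>
  have mem: "\<xi> \<in> tangential_subdiff h x"
    unfolding tangential_subdiff_def
  proof (intro CollectI allI)
    fix u
    show "\<xi> \<bullet> u \<le> ?p u"
      using sub[of u] dir_deriv_subadditive[OF tc, of v u] by linarith
  qed
  then have "\<xi> \<bullet> v \<le> ?p v" by (simp add: tangential_subdiff_def)
  \<comment> \<open>The increment \<open>- v\<close> leads to the origin, where \<open>?p\<close>
    vanishes; this gives the reverse inequality.\<close>
  moreover have "?p v \<le> \<xi> \<bullet> v"
    using sub[of "- v"] by (simp add: dir_deriv_zero)
  ultimately show thesis using that mem by (simp add: order_antisym)
qed

section \<open>Compactness of tangential subdifferentials and a sum rule\<close>

lemma convex_tangential_subdiff: "convex (tangential_subdiff h x)"
proof -
  have "tangential_subdiff h x = (\<Inter>v. {\<xi>. v \<bullet> \<xi> \<le> dir_deriv h x v})"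
    by (auto simp: tangential_subdiff_def inner_commute)
  then show ?thesis by (simp add: convex_INT convex_halfspace_le)
qed

text \<open>Closed as an intersection of half-spaces; testing with \<open>b\<close> and
  \<open>- b\<close> bounds every coordinate. Compactness passes to Minkowski sums, which are
  therefore closed, as strict separation requires.\<close>

lemma compact_tangential_subdiff:
  fixes h :: "'a::euclidean_space \<Rightarrow> real"
  shows "compact (tangential_subdiff h x)"
proof -
  have "tangential_subdiff h x = (\<Inter>v. {\<xi>. v \<bullet> \<xi> \<le> dir_deriv h x v})"
    by (auto simp: tangential_subdiff_def inner_commute)
  then have "closed (tangential_subdiff h x)"
    by (simp add: closed_INT closed_halfspace_le)
  moreover have "norm \<xi> \<le> (\<Sum>b\<in>Basis. \<bar>dir_deriv h x b\<bar> + \<bar>dir_deriv h x (- b)\<bar>)"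
    if "\<xi> \<in> tangential_subdiff h x" for \<xi>
  proof -
    have *: "\<xi> \<bullet> b \<le> dir_deriv h x b" for b
      using that by (simp add: tangential_subdiff_def)
    have "\<bar>\<xi> \<bullet> b\<bar> \<le> \<bar>dir_deriv h x b\<bar> + \<bar>dir_deriv h x (- b)\<bar>" for b
    proof -
      show ?thesis using *[of b] *[of "- b"] unfolding inner_minus_right by linarith
    qed
    then show ?thesis by (intro order_trans[OF norm_le_l1] sum_mono)
  qed
  then have "bounded (tangential_subdiff h x)" by (rule boundedI)
  ultimately show ?thesis by (simp add: compact_eq_bounded_closed)
qed

lemma compact_sum_sets:
  fixes S :: "'i \<Rightarrow> 'a::real_normed_vector set"
  assumes "finite I" "\<And>i. i \<in> I \<Longrightarrow> compact (S i)"
  shows "compact (sum S I)"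
  using assms
proof (induction I rule: finite_induct)
  case empty
  then show ?case by simp
next
  case (insert i I)
  then have "compact {a + b |a b. a \<in> S i \<and> b \<in> sum S I}"
    by (intro compact_sums) blast+
  moreover have "{a + b |a b. a \<in> S i \<and> b \<in> sum S I} = S i + sum S I"
    unfolding set_plus_def by blast
  ultimately show ?case by (simp only: sum.insert[OF insert.hyps])
qed

text \<open>A point outside the compact convex Minkowski sum of the scaled subdifferentials is
  strictly separated from it. Picking in each summand a subgradient that attains the derivative in
  the separating direction contradicts \<open>le\<close>.\<close>

lemma tangential_subdiff_sum_rule:
  fixes h :: "'i \<Rightarrow> 'a::euclidean_space \<Rightarrow> real"
  assumes fin: "finite I" and tc: "\<And>i. i \<in> I \<Longrightarrow> tangentially_convex_at (h i) x"
    and le: "\<And>v. \<zeta> \<bullet> v \<le> (\<Sum>i\<in>I. w i * dir_deriv (h i) x v)"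
  obtains \<xi> where "\<And>i. i \<in> I \<Longrightarrow> \<xi> i \<in> tangential_subdiff (h i) x"
    "\<zeta> = (\<Sum>i\<in>I. w i *\<^sub>R \<xi> i)"
proof -
  let ?S = "\<lambda>i. (\<lambda>\<xi>. w i *\<^sub>R \<xi>) ` tangential_subdiff (h i) x"
  have "\<zeta> \<in> sum ?S I"
  proof (rule ccontr)
    assume "\<zeta> \<notin> sum ?S I"
    moreover have "compact (sum ?S I)"
      by (intro compact_sum_sets compact_scaling compact_tangential_subdiff fin)
    moreover have "convex (sum ?S I)"
      by (intro convex_set_sum convex_scaling convex_tangential_subdiff)
    ultimately obtain a b where ab: "a \<bullet> \<zeta> < b" "\<And>y. y \<in> sum ?S I \<Longrightarrow> a \<bullet> y > b"
      using separating_hyperplane_closed_point[of "sum ?S I" \<zeta>] compact_imp_closed by blast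
    \<comment> \<open>The separation puts the set where \<open>a\<close> is large, while
      \<open>le\<close> bounds \<open>\<zeta>\<close> from above; hence the direction
      \<open>- a\<close>.\<close>
    have "\<exists>\<xi>. \<xi> \<in> tangential_subdiff (h i) x \<and> \<xi> \<bullet> (- a) = dir_deriv (h i) x (- a)"
      if "i \<in> I" for i
      by (rule tangential_subgradient_attaining[OF tc[OF that], of "- a"]) blast
    then obtain \<xi> where \<xi>: "\<And>i. i \<in> I \<Longrightarrow> \<xi> i \<in> tangential_subdiff (h i) x"
      "\<And>i. i \<in> I \<Longrightarrow> \<xi> i \<bullet> (- a) = dir_deriv (h i) x (- a)" by metis
    have "(\<Sum>i\<in>I. w i *\<^sub>R \<xi> i) \<in> sum ?S I"
      using \<xi>(1) by (auto simp: set_sum_alt[OF fin])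
    then have "a \<bullet> (\<Sum>i\<in>I. w i *\<^sub>R \<xi> i) > a \<bullet> \<zeta>" using ab by fastforce
    moreover have "(\<Sum>i\<in>I. w i *\<^sub>R \<xi> i) \<bullet> (- a) = (\<Sum>i\<in>I. w i * dir_deriv (h i) x (- a))"
      unfolding inner_sum_left inner_scaleR_left by (intro sum.cong) (simp_all only: \<xi>(2))
    ultimately show False using le[of "- a"] by (simp add: inner_commute)
  qed
  then obtain s where s: "\<zeta> = sum s I" "\<forall>i\<in>I. s i \<in> ?S i"
    by (auto simp: set_sum_alt[OF fin])
  then have "\<forall>i\<in>I. \<exists>\<xi>. \<xi> \<in> tangential_subdiff (h i) x \<and> s i = w i *\<^sub>R \<xi>" by blast
  then obtain \<xi> where \<xi>: "\<forall>i\<in>I. \<xi> i \<in> tangential_subdiff (h i) x \<and> s i = w i *\<^sub>R \<xi> i"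
    by (rule bchoice[THEN exE])
  then have "sum s I = (\<Sum>i\<in>I. w i *\<^sub>R \<xi> i)" by (intro sum.cong) auto
  with s(1) \<xi> show thesis by (intro that[of \<xi>]) auto
qed

text \<open>Upper semicontinuity in the base point. The Clarke derivative is an upper limit over
  base point and step jointly, so a number above it bounds all nearby quotients; letting only the
  step tend to 0 bounds the derivative at each nearby \<open>y\<close>. Regularity identifies the
  Clarke derivative at \<open>x\<close> with the directional one.\<close>

lemma dir_deriv_eventually_le:
  assumes reg: "clarke_regular_at h x"
    and tc: "\<forall>\<^sub>F y in nhds x. tangentially_convex_at h y" and "e > 0"
  shows "\<forall>\<^sub>F y in nhds x. dir_deriv h y v \<le> dir_deriv h x v + e"
proof -
  obtain d where d: "has_dir_deriv h x v d" "ereal d = clarke_deriv h x v"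
    using reg unfolding clarke_regular_at_def by blast
  have [simp]: "dir_deriv h x v = d" using d(1) by (rule dir_deriv_eqI)
  have "clarke_deriv h x v < ereal (d + e)"
    using \<open>e > 0\<close> by (simp flip: d(2))
  then have "\<forall>\<^sub>F (y, t) in nhds x \<times>\<^sub>F at_right 0. (h (y + t *\<^sub>R v) - h y) / t < d + e"
    unfolding clarke_deriv_def by (auto dest!: Limsup_lessD simp: case_prod_unfold)
  \<comment> \<open>In the product filter the conditions on base point and step decouple, so
    \<open>y\<close> can stay fixed while \<open>t\<close> tends to 0.\<close>
  then obtain P Q where P: "eventually P (nhds x)" and Q: "eventually Q (at_right 0)"
    and PQ: "\<And>y t. P y \<Longrightarrow> Q t \<Longrightarrow> (h (y + t *\<^sub>R v) - h y) / t < d + e"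
    unfolding eventually_prod_filter by auto
  from P tc show ?thesis
  proof eventually_elim
    case (elim y)
    have "\<forall>\<^sub>F t in at_right 0. (h (y + t *\<^sub>R v) - h y) / t \<le> d + e"
      using Q by eventually_elim (use PQ elim in \<open>auto intro: less_imp_le\<close>)
    then show ?case
      using tendsto_upperbound[OF has_dir_deriv_dir_deriv[OF elim(2), unfolded has_dir_deriv_def]]
      by simp
  qed
qed

section \<open>Normal cones\<close>

text \<open>A form free of extended reals and quotients; clearing the denominator is possible
  because the filter excludes \<open>x\<close>. At an isolated point of \<open>S\<close> both sides
  hold for every \<open>\<xi>\<close>, the filter being trivial.\<close>

lemma frechet_normal_cone_iff:
  "\<xi> \<in> frechet_normal_cone S x \<longleftrightarrow>
     (\<forall>e>0. \<forall>\<^sub>F y in at x within S. \<xi> \<bullet> (y - x) \<le> e * norm (y - x))"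
proof -
  have ne: "\<forall>\<^sub>F y in at x within S. y \<noteq> x"
    by (simp add: eventually_at_filter)
  have "\<xi> \<in> frechet_normal_cone S x \<longleftrightarrow>
     (\<forall>c>0. \<forall>\<^sub>F y in at x within S. ereal (\<xi> \<bullet> (y - x) / norm (y - x)) < c)"
    by (simp add: frechet_normal_cone_def Limsup_le_iff)
  also have "\<dots> \<longleftrightarrow> (\<forall>e>0. \<forall>\<^sub>F y in at x within S. \<xi> \<bullet> (y - x) / norm (y - x) < e)"
  proof (intro iffI allI impI)
    fix c :: ereal
    assume e: "\<forall>e>0. \<forall>\<^sub>F y in at x within S. \<xi> \<bullet> (y - x) / norm (y - x) < e" and "c > 0"
    then obtain r where r: "0 < ereal r" "ereal r < c" using ereal_dense2 by blast
    then have "\<forall>\<^sub>F y in at x within S. \<xi> \<bullet> (y - x) / norm (y - x) < r" using e by simp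
    then show "\<forall>\<^sub>F y in at x within S. ereal (\<xi> \<bullet> (y - x) / norm (y - x)) < c"
      by eventually_elim (use r(2) in \<open>auto intro: less_trans[of _ "ereal r"]\<close>)
  next
    fix e :: real
    assume "\<forall>c>0. \<forall>\<^sub>F y in at x within S. ereal (\<xi> \<bullet> (y - x) / norm (y - x)) < c" "e > 0"
    then have "\<forall>\<^sub>F y in at x within S. ereal (\<xi> \<bullet> (y - x) / norm (y - x)) < ereal e"
      by (elim allE[of _ "ereal e"] impE) simp_all
    then show "\<forall>\<^sub>F y in at x within S. \<xi> \<bullet> (y - x) / norm (y - x) < e" by simp
  qed
  also have "\<dots> \<longleftrightarrow> (\<forall>e>0. \<forall>\<^sub>F y in at x within S. \<xi> \<bullet> (y - x) \<le> e * norm (y - x))"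
  proof (intro iffI allI impI)
    fix e :: real
    assume "\<forall>e>0. \<forall>\<^sub>F y in at x within S. \<xi> \<bullet> (y - x) / norm (y - x) < e" "e > 0"
    then have "\<forall>\<^sub>F y in at x within S. \<xi> \<bullet> (y - x) / norm (y - x) < e" by blast
    with ne show "\<forall>\<^sub>F y in at x within S. \<xi> \<bullet> (y - x) \<le> e * norm (y - x)"
      by eventually_elim (simp add: divide_less_eq)
  next
    fix e :: real
    assume a: "\<forall>e>0. \<forall>\<^sub>F y in at x within S. \<xi> \<bullet> (y - x) \<le> e * norm (y - x)" and "e > 0"
    \<comment> \<open>Half of \<open>e\<close> leaves room to turn the weak inequality into a strict
      one.\<close>
    then have "\<forall>\<^sub>F y in at x within S. \<xi> \<bullet> (y - x) \<le> e / 2 * norm (y - x)"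
      by (elim allE[of _ "e / 2"] impE) simp_all
    with ne show "\<forall>\<^sub>F y in at x within S. \<xi> \<bullet> (y - x) / norm (y - x) < e"
    proof eventually_elim
      case (elim y)
      then have "\<xi> \<bullet> (y - x) / norm (y - x) \<le> e / 2" by (simp add: divide_le_eq)
      with \<open>e > 0\<close> show ?case by linarith
    qed
  qed
  finally show ?thesis .
qed

lemma frechet_normal_cone_scaleR:
  assumes "\<xi> \<in> frechet_normal_cone S x" "a \<ge> 0"
  shows "a *\<^sub>R \<xi> \<in> frechet_normal_cone S x"
proof (cases "a = 0")
  case True
  then show ?thesis by (simp add: frechet_normal_cone_iff)
next
  case False
  with assms(2) have "a > 0" by simp
  show ?thesis unfolding frechet_normal_cone_iff
  proof (intro allI impI)
    fix e :: real assume "e > 0"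
    with \<open>a > 0\<close> have "e / a > 0" by simp
    with assms(1) have "\<forall>\<^sub>F y in at x within S. \<xi> \<bullet> (y - x) \<le> e / a * norm (y - x)"
      unfolding frechet_normal_cone_iff by blast
    then show "\<forall>\<^sub>F y in at x within S. (a *\<^sub>R \<xi>) \<bullet> (y - x) \<le> e * norm (y - x)"
      by eventually_elim (use \<open>a > 0\<close> in \<open>simp add: field_simps\<close>)
  qed
qed

lemma limiting_normal_cone_scaleR:
  assumes "\<xi> \<in> limiting_normal_cone S x" "a \<ge> 0"
  shows "a *\<^sub>R \<xi> \<in> limiting_normal_cone S x"
proof -
  obtain xk \<xi>k where "\<forall>k. xk k \<in> S" "xk \<longlonglongrightarrow> x" "\<xi>k \<longlonglongrightarrow> \<xi>"
    "\<forall>k. \<xi>k k \<in> frechet_normal_cone S (xk k)"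
    using assms(1) unfolding limiting_normal_cone_def by blast
  moreover from this have "(\<lambda>k. a *\<^sub>R \<xi>k k) \<longlonglongrightarrow> a *\<^sub>R \<xi>" by (intro tendsto_scaleR tendsto_const)
  moreover have "\<forall>k. a *\<^sub>R \<xi>k k \<in> frechet_normal_cone S (xk k)"
    using calculation assms(2) by (simp add: frechet_normal_cone_scaleR)
  ultimately show ?thesis unfolding limiting_normal_cone_def by blast
qed

text \<open>Proximal normals are Frechet normals: expanding the square of
  \<open>norm (y - z')\<close> bounds twice the inner product by the square of
  \<open>norm (z' - z)\<close>, which is of smaller order than \<open>norm (z' - z)\<close>.\<close>

lemma frechet_normal_of_nearest_point:
  assumes near: "\<forall>\<^sub>F z' in at z within S. norm (y - z) \<le> norm (y - z')"
  shows "y - z \<in> frechet_normal_cone S z"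
  unfolding frechet_normal_cone_iff
proof (intro allI impI)
  fix e :: real assume "e > 0"
  then have "\<forall>\<^sub>F z' in at z within S. dist z' z < 2 * e"
    by (intro tendstoD[OF tendsto_ident_at]) simp
  with near show "\<forall>\<^sub>F z' in at z within S. (y - z) \<bullet> (z' - z) \<le> e * norm (z' - z)"
  proof eventually_elim
    case (elim z')
    have "(norm (y - z))\<^sup>2 \<le> (norm (y - z'))\<^sup>2" using elim(1) by (simp add: power_mono)
    also have "\<dots> = (norm (y - z))\<^sup>2 - 2 * ((y - z) \<bullet> (z' - z)) + (norm (z' - z))\<^sup>2"
      unfolding power2_norm_eq_inner by (simp add: algebra_simps inner_commute)
    finally have "2 * ((y - z) \<bullet> (z' - z)) \<le> norm (z' - z) * norm (z' - z)"
      by (simp add: power2_eq_square)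
    also have "\<dots> \<le> (2 * e) * norm (z' - z)"
      using elim(2) by (intro mult_right_mono) (auto simp: dist_norm)
    finally show ?case by simp
  qed
qed

section \<open>Penalised minimisation\<close>

text \<open>Squaring smooths the kink of the positive part, so a two-sided derivative exists
  everywhere and the function can stand outside in a chain rule.\<close>

lemma DERIV_max_0_squared: "((\<lambda>s::real. (max 0 s)\<^sup>2) has_real_derivative 2 * max 0 s) (at s)"
proof -
  consider "s > 0" | "s < 0" | "s = 0" by linarith
  then show ?thesis
  proof cases
    case 1
    then have "\<forall>\<^sub>F t in nhds s. 0 < t" by (intro eventually_nhds_in_open[of "{0<..}", simplified]) auto
    then have "\<forall>\<^sub>F t in nhds s. (max 0 t)\<^sup>2 = t\<^sup>2" by eventually_elim simp
    moreover have "((\<lambda>t. t\<^sup>2) has_real_derivative 2 * max 0 s) (at s)"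
      using 1 by (auto intro!: derivative_eq_intros)
    ultimately show ?thesis by (subst DERIV_cong_ev[OF refl _ refl])
  next
    case 2
    then have "\<forall>\<^sub>F t in nhds s. t < 0" by (intro eventually_nhds_in_open[of "{..<0}", simplified]) auto
    then have "\<forall>\<^sub>F t in nhds s. (max 0 t)\<^sup>2 = 0" by eventually_elim simp
    moreover have "((\<lambda>t. 0) has_real_derivative 2 * max 0 s) (at s)"
      using 2 by simp
    ultimately show ?thesis by (subst DERIV_cong_ev[OF refl _ refl])
  next
    case 3
    \<comment> \<open>At the kink the quotient equals \<open>t\<close> for positive \<open>t\<close>
      and 0 otherwise.\<close>
    have "\<bar>((max 0 t)\<^sup>2 - (max 0 0)\<^sup>2) / (t - 0)\<bar> \<le> \<bar>t\<bar>" for t :: real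
      by (cases "t > 0") (auto simp: power2_eq_square max_def)
    then have "\<forall>\<^sub>F t in at (0::real). norm (((max 0 t)\<^sup>2 - (max 0 0)\<^sup>2) / (t - 0)) \<le> \<bar>t\<bar>"
      by (simp only: real_norm_def eventually_True)
    from Lim_null_comparison[OF this tendsto_rabs_zero[OF tendsto_ident_at]]
    have "((\<lambda>t::real. ((max 0 t)\<^sup>2 - (max 0 0)\<^sup>2) / (t - 0)) \<longlongrightarrow> 0) (at 0)" .
    with 3 show ?thesis by (simp add: has_field_derivative_iff)
  qed
qed

text \<open>Chain rule with a merely one-sided inner derivative. The factor
  \<open>2 * max 0 (h x)\<close>, scaled by the penalty parameter, later becomes a
  multiplier.\<close>

lemma has_dir_deriv_max_0_squared:
  assumes "has_dir_deriv h x v d"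
  shows "has_dir_deriv (\<lambda>y. (max 0 (h y))\<^sup>2) x v (2 * max 0 (h x) * d)"
proof -
  have "((\<lambda>s. (max 0 s)\<^sup>2) has_real_derivative 2 * max 0 (h x)) (at (h (x + 0 *\<^sub>R v)))"
    using DERIV_max_0_squared[of "h x"] by simp
  from DERIV_chain2[OF this assms[unfolded has_dir_deriv_iff_field_derivative]]
  show ?thesis unfolding has_dir_deriv_iff_field_derivative .
qed

lemma has_dir_deriv_norm_squared:
  fixes x :: "'a::real_inner"
  shows "has_dir_deriv (\<lambda>y. (norm (y - z))\<^sup>2) x v (2 * ((x - z) \<bullet> v))"
proof -
  have "(norm (x + t *\<^sub>R v - z))\<^sup>2
      = (norm (x - z))\<^sup>2 + t * (2 * ((x - z) \<bullet> v)) + t\<^sup>2 * (norm v)\<^sup>2" for t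
  proof -
    have "x + t *\<^sub>R v - z = (x - z) + t *\<^sub>R v" by simp
    then show ?thesis
      unfolding power2_norm_eq_inner
      by (simp only: inner_add_left inner_add_right inner_scaleR_left inner_scaleR_right
          inner_commute[of v "x - z"]) (simp add: ring_distribs power2_eq_square)
  qed
  moreover have "((\<lambda>t. (norm (x - z))\<^sup>2 + t * (2 * ((x - z) \<bullet> v)) + t\<^sup>2 * (norm v)\<^sup>2)
      has_field_derivative 2 * ((x - z) \<bullet> v)) (at_right 0)"
    by (auto intro!: derivative_eq_intros)
  ultimately show ?thesis by (simp only: has_dir_deriv_iff_field_derivative)
qed

lemma has_dir_deriv_nonneg:
  assumes d: "has_dir_deriv h x v d" and min: "\<forall>\<^sub>F y in nhds x. h x \<le> h y"
  shows "0 \<le> d"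
proof -
  have "((\<lambda>t. x + t *\<^sub>R v) \<longlongrightarrow> x + 0 *\<^sub>R v) (at_right 0)"
    by (intro tendsto_intros)
  then have "filterlim (\<lambda>t. x + t *\<^sub>R v) (nhds x) (at_right 0)" by simp
  with min have "\<forall>\<^sub>F t in at_right 0. h x \<le> h (x + t *\<^sub>R v)"
    by (rule eventually_compose_filterlim)
  moreover have "\<forall>\<^sub>F t in at_right 0. (0::real) < t"
    by (simp add: eventually_at_right_less)
  ultimately have "\<forall>\<^sub>F t in at_right 0. 0 \<le> (h (x + t *\<^sub>R v) - h x) / t"
    by eventually_elim simp
  with d show ?thesis
    unfolding has_dir_deriv_def by (intro tendsto_lowerbound) auto
qed

text \<open>The term |y - x|^2 stands outside the factor \<open>c\<close>: it singles out
  \<open>x\<close> as the limit of the minimisers even if \<open>x\<close> is not a strict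
  minimiser. \<open>y\<close> is the last argument so that fixing \<open>z\<close> leaves a function
  to which directional derivatives apply.\<close>

definition penalty ::
    "('a::real_inner \<Rightarrow> real) \<Rightarrow> ('i \<Rightarrow> 'a \<Rightarrow> real) \<Rightarrow> 'i set \<Rightarrow> 'a \<Rightarrow> real \<Rightarrow> 'a \<Rightarrow> 'a \<Rightarrow> real" where
  "penalty f g J x c z y =
     f y + c * ((\<Sum>j\<in>J. (max 0 (g j y))\<^sup>2) + (norm (y - z))\<^sup>2) + (norm (y - x))\<^sup>2"

lemma penalty_stationary:
  assumes f: "tangentially_convex_at f y" and g: "\<And>j. j \<in> J \<Longrightarrow> tangentially_convex_at (g j) y"
    and min: "\<forall>\<^sub>F y' in nhds y. penalty f g J x c z y \<le> penalty f g J x c z y'"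
  shows "0 \<le> dir_deriv f y v + (\<Sum>j\<in>J. 2 * c * max 0 (g j y) * dir_deriv (g j) y v)
           + ((2 * c) *\<^sub>R (y - z)) \<bullet> v + 2 * ((y - x) \<bullet> v)"
proof -
  have "has_dir_deriv (penalty f g J x c z) y v
     (dir_deriv f y v + c * ((\<Sum>j\<in>J. 2 * max 0 (g j y) * dir_deriv (g j) y v)
        + 2 * ((y - z) \<bullet> v)) + 2 * ((y - x) \<bullet> v))"
    unfolding has_dir_deriv_iff_field_derivative penalty_def
    by (intro DERIV_add DERIV_cmult DERIV_sum
        has_dir_deriv_max_0_squared[unfolded has_dir_deriv_iff_field_derivative]
        has_dir_deriv_norm_squared[unfolded has_dir_deriv_iff_field_derivative]
        has_dir_deriv_dir_deriv[unfolded has_dir_deriv_iff_field_derivative] f g)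
  from has_dir_deriv_nonneg[OF this min] show ?thesis
    by (simp add: ring_distribs sum_distrib_left mult.assoc mult.left_commute[of c])
qed

text \<open>Exterior penalty argument on a compact product: bounded penalised values force the
  violation \<open>W\<close> to vanish in the limit, so the limit point is feasible, and the
  localising square identifies it with \<open>(x, x)\<close>.\<close>

lemma penalty_minimizers:
  fixes x :: "'a::euclidean_space"
  assumes X: "closed X" "x \<in> X" and e: "e > 0"
    and feas: "\<And>j. j \<in> J \<Longrightarrow> g j x \<le> 0"
    and min: "\<And>y. y \<in> X \<inter> cball x e \<Longrightarrow> (\<And>j. j \<in> J \<Longrightarrow> g j y \<le> 0) \<Longrightarrow> f x \<le> f y"
    and fin: "finite J"
    and cont_f: "continuous_on (cball x e) f"
    and cont_g: "\<And>j. j \<in> J \<Longrightarrow> continuous_on (cball x e) (g j)"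
  obtains c :: "nat \<Rightarrow> real" and y z where "\<And>k. c k \<ge> 0" "y \<longlonglongrightarrow> x" "z \<longlonglongrightarrow> x"
    "\<And>k. z k \<in> X"
    "\<And>k y' z'. y' \<in> cball x e \<Longrightarrow> z' \<in> X \<inter> cball x e \<Longrightarrow>
       penalty f g J x (c k) (z k) (y k) \<le> penalty f g J x (c k) z' y'"
proof -
  define W where "W = (\<lambda>(y, z). (\<Sum>j\<in>J. (max 0 (g j y))\<^sup>2) + (norm (y - z))\<^sup>2)"
  define K where "K = cball x e \<times> (X \<inter> cball x e)"
  have K: "compact K" "(x, x) \<in> K"
    using X e by (auto simp: K_def intro!: compact_Times closed_Int_compact)
  have pen: "penalty f g J x c z y = f y + c * W (y, z) + (norm (y - x))\<^sup>2" for c y z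
    by (simp add: penalty_def W_def)
  have W0: "W p \<ge> 0" for p
    by (auto simp: W_def case_prod_unfold intro!: add_nonneg_nonneg sum_nonneg)
  have cf: "continuous_on K (\<lambda>p. f (fst p))"
    by (rule continuous_on_compose2[OF cont_f continuous_on_fst[OF continuous_on_id]])
      (auto simp: K_def)
  have cg: "continuous_on K (\<lambda>p. g j (fst p))" if "j \<in> J" for j
    by (rule continuous_on_compose2[OF cont_g[OF that] continuous_on_fst[OF continuous_on_id]])
      (auto simp: K_def)
  have cW: "continuous_on K W"
    unfolding W_def case_prod_unfold by (intro continuous_intros cg)
  \<comment> \<open>Minimisers exist for each integer parameter \<open>k\<close>; the parameters
    finally returned are the \<open>real (r k)\<close> of a subsequence.\<close>
  have "\<exists>p\<in>K. \<forall>p'\<in>K. f (fst p) + real k * W p + (norm (fst p - x))\<^sup>2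
      \<le> f (fst p') + real k * W p' + (norm (fst p' - x))\<^sup>2" for k
    using K(2) by (intro continuous_attains_inf K(1) continuous_intros cf cW) auto
  then obtain p where p: "\<And>k. p k \<in> K" "\<And>k p'. p' \<in> K \<Longrightarrow>
      f (fst (p k)) + real k * W (p k) + (norm (fst (p k) - x))\<^sup>2
      \<le> f (fst p') + real k * W p' + (norm (fst p' - x))\<^sup>2" by metis
  obtain pb r where pb: "pb \<in> K" and r: "strict_mono r" and lim: "(p \<circ> r) \<longlonglongrightarrow> pb"
    using compact_imp_seq_compact[OF K(1)] p(1) unfolding seq_compact_def by metis
  have "W (x, x) = 0" using feas by (simp add: W_def max_absorb1)
  \<comment> \<open>Comparison with the competitor \<open>(x, x)\<close>, where the violation is
    zero.\<close>
  then have ub: "f (fst (p k)) + real k * W (p k) + (norm (fst (p k) - x))\<^sup>2 \<le> f x" for k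
    using p(2)[OF K(2), of k] by simp
  obtain m where m: "\<And>q. q \<in> K \<Longrightarrow> m \<le> f (fst q)"
    using continuous_attains_inf[OF K(1) _ cf] K(2) by blast
  have lim_r: "(\<lambda>k. u (p (r k))) \<longlonglongrightarrow> u pb" if "continuous_on K u" for u :: "'a \<times> 'a \<Rightarrow> real"
    using continuous_on_tendsto_compose[OF that lim pb] p(1) by (simp add: o_def)
  \<comment> \<open>Index 0 is left out because \<open>r 0\<close> may be 0.\<close>
  have "W (p (r k)) \<le> (f x - m) / real (r k)" if "k \<ge> 1" for k
  proof -
    have "r k > 0" using seq_suble[OF r, of k] that by linarith
    moreover have "real (r k) * W (p (r k)) \<le> f x - m"
      using ub[of "r k"] m[OF p(1), of "r k"] zero_le_power2[of "norm (fst (p (r k)) - x)"]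
      by linarith
    ultimately show ?thesis by (simp add: field_simps)
  qed
  moreover have "(\<lambda>k. (f x - m) / real (r k)) \<longlonglongrightarrow> 0"
    by (rule LIMSEQ_subseq_LIMSEQ[OF lim_const_over_n[of "f x - m"] r, unfolded o_def])
  ultimately have "W pb \<le> 0"
    by (intro LIMSEQ_le[OF lim_r[OF cW]]) auto
  obtain yb zb where yz: "pb = (yb, zb)" by (cases pb)
  have "W pb = 0" using \<open>W pb \<le> 0\<close> W0[of pb] by simp
  then have s0: "(\<Sum>j\<in>J. (max 0 (g j yb))\<^sup>2) + (norm (yb - zb))\<^sup>2 = 0"
    by (simp add: W_def yz)
  have "(\<Sum>j\<in>J. (max 0 (g j yb))\<^sup>2) \<ge> 0" by (intro sum_nonneg) simp
  with s0 have s1: "(\<Sum>j\<in>J. (max 0 (g j yb))\<^sup>2) = 0" and "(norm (yb - zb))\<^sup>2 = 0"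
    using zero_le_power2[of "norm (yb - zb)"] by linarith+
  then have "yb = zb" by simp
  have "g j yb \<le> 0" if "j \<in> J" for j
  proof -
    have "(max 0 (g j yb))\<^sup>2 = 0"
      using s1 that fin by (subst (asm) sum_nonneg_eq_0_iff) auto
    then show ?thesis by (simp add: max_def split: if_splits)
  qed
  then have "f x \<le> f yb"
    using pb \<open>yb = zb\<close> by (intro min) (auto simp: K_def yz)
  \<comment> \<open>The term \<open>real k * W (p k)\<close> is nonnegative and is dropped before
    passing to the limit, since nothing is known about its own limit.\<close>
  moreover have "f yb + (norm (yb - x))\<^sup>2 \<le> f x"
  proof -
    have "continuous_on K (\<lambda>q. f (fst q) + (norm (fst q - x))\<^sup>2)"
      by (intro continuous_intros cf)
    from lim_r[OF this] have
      "(\<lambda>k. f (fst (p (r k))) + (norm (fst (p (r k)) - x))\<^sup>2) \<longlonglongrightarrow> f yb + (norm (yb - x))\<^sup>2"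
      by (simp add: yz)
    moreover have "f (fst (p k)) + (norm (fst (p k) - x))\<^sup>2 \<le> f x" for k
    proof -
      have "0 \<le> real k * W (p k)" using W0 by simp
      then show ?thesis using ub[of k] by linarith
    qed
    ultimately show ?thesis by (intro LIMSEQ_le_const2) auto
  qed
  ultimately have "(norm (yb - x))\<^sup>2 \<le> 0" by linarith
  then have "yb = x" by simp
  then have "pb = (x, x)" using yz \<open>yb = zb\<close> by simp
  show thesis
  proof (rule that[of "\<lambda>k. real (r k)" "\<lambda>k. fst (p (r k))" "\<lambda>k. snd (p (r k))"])
    show "(\<lambda>k. fst (p (r k))) \<longlonglongrightarrow> x" "(\<lambda>k. snd (p (r k))) \<longlonglongrightarrow> x"
      using tendsto_fst[OF lim] tendsto_snd[OF lim] \<open>pb = (x, x)\<close> by (simp_all add: o_def)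
    show "snd (p (r k)) \<in> X" for k using p(1)[of "r k"] by (auto simp: K_def)
    show "penalty f g J x (real (r k)) (snd (p (r k))) (fst (p (r k)))
        \<le> penalty f g J x (real (r k)) z' y'"
      if "y' \<in> cball x e" "z' \<in> X \<inter> cball x e" for k y' z'
      using p(2)[of "(y', z')" "r k"] that by (simp add: pen K_def)
  qed simp
qed

text \<open>Only c |y - z|^2 depends on \<open>z\<close>, so for positive \<open>c\<close> a
  minimiser in \<open>z\<close> is locally a nearest point of \<open>X\<close> to \<open>y\<close>.
  As \<open>z\<close> lies in the open ball, nearby points of \<open>X\<close> are admissible
  competitors.\<close>

lemma penalty_frechet_normal:
  fixes x :: "'a::real_inner"
  assumes "c \<ge> 0" and "z \<in> ball x e" and "y \<in> cball x e"
    and min: "\<And>z'. z' \<in> X \<inter> cball x e \<Longrightarrow> penalty f g J x c z y \<le> penalty f g J x c z' y"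
  shows "c *\<^sub>R (y - z) \<in> frechet_normal_cone X z"
proof (cases "c = 0")
  case True
  then show ?thesis by (simp add: frechet_normal_cone_iff)
next
  case False
  have "\<forall>\<^sub>F z' in at z within X. norm (y - z) \<le> norm (y - z')"
    unfolding eventually_at_filter
    using eventually_nhds_in_open[OF open_ball assms(2)]
  proof eventually_elim
    case (elim z')
    show ?case
    proof (intro impI)
      assume "z' \<in> X"
      then have "c * (norm (y - z))\<^sup>2 \<le> c * (norm (y - z'))\<^sup>2"
        using min[of z'] elim by (simp add: penalty_def ring_distribs)
      then show "norm (y - z) \<le> norm (y - z')"
        using False assms(1) by (simp add: power2_le_iff_abs_le)
    qed
  qed
  from frechet_normal_cone_scaleR[OF frechet_normal_of_nearest_point[OF this] assms(1)]
  show ?thesis .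
qed

section \<open>Multipliers\<close>

text \<open>Bolzano-Weierstrass for finitely many coordinates, obtained from
  \<open>compact_lemma_general\<close> with functions as vectors and evaluation as
  projection.\<close>

lemma finite_family_convergent_subsequence:
  fixes a :: "nat \<Rightarrow> 'i \<Rightarrow> real"
  assumes "finite I" and "\<And>i. i \<in> I \<Longrightarrow> bounded (range (\<lambda>k. a k i))"
  obtains r :: "nat \<Rightarrow> nat" and l where "strict_mono r"
    "\<And>i. i \<in> I \<Longrightarrow> (\<lambda>k. a (r k) i) \<longlonglongrightarrow> l i"
proof -
  have "\<forall>\<delta>\<subseteq>I. \<exists>l r. strict_mono (r::nat \<Rightarrow> nat) \<and>
      (\<forall>e>0. \<forall>\<^sub>F n in sequentially. \<forall>i\<in>\<delta>. dist (a (r n) i) (l i) < e)"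
    using assms
    by (intro compact_lemma_general[where proj = "\<lambda>u i. u i" and unproj = "\<lambda>u. u" and f = a])
      (auto simp: image_image)
  then obtain l r where r: "strict_mono (r::nat \<Rightarrow> nat)"
    and lim: "\<And>e. e > 0 \<Longrightarrow> \<forall>\<^sub>F n in sequentially. \<forall>i\<in>I. dist (a (r n) i) (l i) < e"
    by blast
  have "(\<lambda>k. a (r k) i) \<longlonglongrightarrow> l i" if "i \<in> I" for i
  proof (rule tendstoI)
    fix e :: real assume "e > 0"
    from lim[OF this] show "\<forall>\<^sub>F k in sequentially. dist (a (r k) i) (l i) < e"
      by eventually_elim (use that in blast)
  qed
  with r show thesis by (rule that)
qed

text \<open>The objective joins the constraints in one family, at index \<open>i0\<close>, so that
  its weight may degenerate to 0 like any other. The sequence \<open>y\<close> violates every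
  constraint of positive weight; both quasinormality and complementarity will use it.\<close>

lemma fritz_john:
  fixes x :: "'a::euclidean_space" and h :: "'i \<Rightarrow> 'a \<Rightarrow> real"
  assumes X: "closed X" "x \<in> X" and e: "e > 0"
    and fin: "finite J" and i0: "i0 \<notin> J"
    and feas: "\<And>j. j \<in> J \<Longrightarrow> h j x \<le> 0"
    and min: "\<And>y. y \<in> X \<inter> cball x e \<Longrightarrow> (\<And>j. j \<in> J \<Longrightarrow> h j y \<le> 0) \<Longrightarrow> h i0 x \<le> h i0 y"
    and cont: "\<And>i. i \<in> insert i0 J \<Longrightarrow> continuous_on (cball x e) (h i)"
    and tc: "\<And>i. i \<in> insert i0 J \<Longrightarrow> \<forall>\<^sub>F y in nhds x. tangentially_convex_at (h i) y"
    and reg: "\<And>i. i \<in> insert i0 J \<Longrightarrow> clarke_regular_at (h i) x"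
  obtains l \<eta> y where "\<And>i. i \<in> insert i0 J \<Longrightarrow> 0 \<le> l i" "sum l (insert i0 J) = 1"
    "\<eta> \<in> limiting_normal_cone X x"
    "\<And>v. 0 \<le> (\<Sum>i\<in>insert i0 J. l i * dir_deriv (h i) x v) + \<eta> \<bullet> v"
    "y \<longlonglongrightarrow> x" "\<And>j k. j \<in> J \<Longrightarrow> l j > 0 \<Longrightarrow> h j (y k) > 0"
proof -
  let ?I = "insert i0 J"
  have finI: "finite ?I" using fin by simp
  obtain c :: "nat \<Rightarrow> real" and y z where c: "\<And>k. c k \<ge> 0" and y: "y \<longlonglongrightarrow> x" and z: "z \<longlonglongrightarrow> x"
    and zX: "\<And>k. z k \<in> X"
    and pmin: "\<And>k y' z'. y' \<in> cball x e \<Longrightarrow> z' \<in> X \<inter> cball x e \<Longrightarrow>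
       penalty (h i0) h J x (c k) (z k) (y k) \<le> penalty (h i0) h J x (c k) z' y'"
    by (rule penalty_minimizers[of X x e J h "h i0"]) (use X e feas min fin cont in auto)
  \<comment> \<open>Unnormalised multipliers from the derivative of the penalty. The entry 1 of the
    objective keeps \<open>D k\<close> at least 1.\<close>
  define m where "m k i = (if i = i0 then 1 else 2 * c k * max 0 (h i (y k)))" for k i
  define D where "D k = sum (m k) ?I" for k
  define w where "w k i = m k i / D k" for k i
  define \<eta> where "\<eta> k = (2 * c k / D k) *\<^sub>R (y k - z k)" for k
  have m0: "m k i \<ge> 0" for k i using c by (simp add: m_def)
  have D1: "D k \<ge> 1" for k
  proof -
    have "D k = 1 + sum (m k) J"
      using fin i0 by (simp add: D_def m_def)
    then show ?thesis using sum_nonneg[of J "m k"] m0 by simp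
  qed
  have w0: "w k i \<ge> 0" for k i using m0 D1[of k] by (simp add: w_def)
  have wsum: "sum (w k) ?I = 1" for k
    using D1[of k] unfolding w_def D_def[symmetric] sum_divide_distrib[symmetric] by simp
  have w1: "w k i \<le> 1" if "i \<in> ?I" for k i
    using member_le_sum[of i ?I "w k"] that finI w0 wsum[of k] by simp

  have ev_y: "\<forall>\<^sub>F k in sequentially. y k \<in> ball x e"
    and ev_z: "\<forall>\<^sub>F k in sequentially. z k \<in> ball x e"
    using topological_tendstoD[OF y open_ball] topological_tendstoD[OF z open_ball] e by auto
  have ev_normal: "\<forall>\<^sub>F k in sequentially. \<eta> k \<in> frechet_normal_cone X (z k)"
    using ev_y ev_z
  proof eventually_elim
    case (elim k)
    then have "c k *\<^sub>R (y k - z k) \<in> frechet_normal_cone X (z k)"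
      by (intro penalty_frechet_normal[where f = "h i0" and g = h and J = J, OF c]) (auto intro: pmin)
    from frechet_normal_cone_scaleR[OF this, of "2 / D k"] show ?case
      using D1[of k] by (simp add: \<eta>_def mult.commute)
  qed
  have ev_tc: "\<forall>\<^sub>F k in sequentially. \<forall>i\<in>?I. tangentially_convex_at (h i) (y k)"
    using finI by (intro eventually_ball_finite ballI eventually_compose_filterlim[OF tc y]) auto
  \<comment> \<open>Minimality over the closed ball is unconstrained local minimality once
    \<open>y k\<close> lies in the open ball. Dividing by \<open>D k\<close> makes the weights a
    convex combination.\<close>
  have ev_stat: "\<forall>\<^sub>F k in sequentially. \<forall>v. 0 \<le> (\<Sum>i\<in>?I. w k i * dir_deriv (h i) (y k) v)
      + \<eta> k \<bullet> v + 2 / D k * ((y k - x) \<bullet> v)"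
    using ev_y ev_z ev_tc
  proof eventually_elim
    case (elim k)
    show ?case
    proof
      fix v
      have "\<forall>\<^sub>F y' in nhds (y k). penalty (h i0) h J x (c k) (z k) (y k)
          \<le> penalty (h i0) h J x (c k) (z k) y'"
        using eventually_nhds_in_open[OF open_ball elim(1)]
        by eventually_elim (use elim zX in \<open>auto intro!: pmin\<close>)
      then have "0 \<le> dir_deriv (h i0) (y k) v
          + (\<Sum>j\<in>J. 2 * c k * max 0 (h j (y k)) * dir_deriv (h j) (y k) v)
          + ((2 * c k) *\<^sub>R (y k - z k)) \<bullet> v + 2 * ((y k - x) \<bullet> v)"
        using elim(3) by (intro penalty_stationary) auto
      also have "(\<Sum>j\<in>J. 2 * c k * max 0 (h j (y k)) * dir_deriv (h j) (y k) v)
          = (\<Sum>j\<in>J. m k j * dir_deriv (h j) (y k) v)"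
        using i0 by (intro sum.cong) (auto simp: m_def)
      also have "dir_deriv (h i0) (y k) v + (\<Sum>j\<in>J. m k j * dir_deriv (h j) (y k) v)
          = (\<Sum>i\<in>?I. m k i * dir_deriv (h i) (y k) v)"
        using fin i0 by (simp add: m_def)
      finally have "0 \<le> ((\<Sum>i\<in>?I. m k i * dir_deriv (h i) (y k) v)
          + ((2 * c k) *\<^sub>R (y k - z k)) \<bullet> v + 2 * ((y k - x) \<bullet> v)) / D k"
        using D1[of k] by (intro divide_nonneg_nonneg) auto
      also have "\<dots> = (\<Sum>i\<in>?I. w k i * dir_deriv (h i) (y k) v)
          + \<eta> k \<bullet> v + 2 / D k * ((y k - x) \<bullet> v)"
        unfolding add_divide_distrib sum_divide_distrib by (simp add: w_def \<eta>_def)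
      finally show "0 \<le> (\<Sum>i\<in>?I. w k i * dir_deriv (h i) (y k) v)
          + \<eta> k \<bullet> v + 2 / D k * ((y k - x) \<bullet> v)" .
    qed
  qed
  \<comment> \<open>Derivatives at \<open>y k\<close> are traded for those at \<open>x\<close>;
    since the weights sum to 1, the errors add up to a single \<open>d\<close>.\<close>
  have ev_upper: "\<forall>\<^sub>F k in sequentially. 0 \<le> (\<Sum>i\<in>?I. w k i * dir_deriv (h i) x v) + d
      + \<eta> k \<bullet> v + 2 * norm (y k - x) * norm v" if "d > 0" for v d
  proof -
    have "\<forall>\<^sub>F k in sequentially. \<forall>i\<in>?I. dir_deriv (h i) (y k) v \<le> dir_deriv (h i) x v + d"
      using finI that reg tc
      by (intro eventually_ball_finite ballI
          eventually_compose_filterlim[OF dir_deriv_eventually_le y]) auto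
    with ev_stat show ?thesis
    proof eventually_elim
      case (elim k)
      have "(\<Sum>i\<in>?I. w k i * dir_deriv (h i) (y k) v)
          \<le> (\<Sum>i\<in>?I. w k i * (dir_deriv (h i) x v + d))"
        using elim(2) w0 by (intro sum_mono mult_left_mono) auto
      also have "\<dots> = (\<Sum>i\<in>?I. w k i * dir_deriv (h i) x v) + d"
        unfolding ring_distribs sum.distrib sum_distrib_right[symmetric] wsum by simp
      finally have a: "(\<Sum>i\<in>?I. w k i * dir_deriv (h i) (y k) v)
          \<le> (\<Sum>i\<in>?I. w k i * dir_deriv (h i) x v) + d" .
      have "2 / D k * ((y k - x) \<bullet> v) \<le> 2 / D k * (norm (y k - x) * norm v)"
        using D1[of k] norm_cauchy_schwarz[of "y k - x" v] by (intro mult_left_mono) auto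
      also have "\<dots> \<le> 2 * (norm (y k - x) * norm v)"
        using D1[of k] by (intro mult_right_mono) (auto simp: divide_le_eq)
      finally show ?case using a elim(1)[rule_format, of v] by linarith
    qed
  qed
  have yx0: "(\<lambda>k. norm (y k - x)) \<longlonglongrightarrow> 0"
    using y by (simp add: tendsto_norm_zero LIM_zero)

  \<comment> \<open>Boundedness of \<open>\<eta>\<close> comes from stationarity itself: in each
    direction every other term is bounded, so \<open>- (\<eta> k \<bullet> v)\<close> is bounded
    above. Opposite basis vectors then bound the norm.\<close>
  have bound: "\<exists>M. \<forall>\<^sub>F k in sequentially. - (\<eta> k \<bullet> v) \<le> M" for v
  proof -
    have "\<forall>\<^sub>F k in sequentially. norm (y k - x) < 1"
      using order_tendstoD(2)[OF yx0] by simp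
    with ev_upper[of 1 v, OF zero_less_one]
    have "\<forall>\<^sub>F k in sequentially. - (\<eta> k \<bullet> v) \<le> (\<Sum>i\<in>?I. \<bar>dir_deriv (h i) x v\<bar>) + 1 + 2 * norm v"
    proof eventually_elim
      case (elim k)
      have "w k i * dir_deriv (h i) x v \<le> \<bar>dir_deriv (h i) x v\<bar>" if "i \<in> ?I" for i
        using mult_mono[OF w1[OF that, of k] abs_ge_self[of "dir_deriv (h i) x v"]]
          mult_left_mono[OF abs_ge_self[of "dir_deriv (h i) x v"] w0[of k i]]
          mult_right_mono[OF w1[OF that, of k], of "\<bar>dir_deriv (h i) x v\<bar>"] by linarith
      then have "(\<Sum>i\<in>?I. w k i * dir_deriv (h i) x v) \<le> (\<Sum>i\<in>?I. \<bar>dir_deriv (h i) x v\<bar>)"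
        by (rule sum_mono)
      moreover have "norm (y k - x) * norm v \<le> 1 * norm v"
        using elim(2) by (intro mult_right_mono) auto
      ultimately show ?case using elim(1) by linarith
    qed
    then show ?thesis by blast
  qed
  obtain M where M: "\<And>v. \<forall>\<^sub>F k in sequentially. - (\<eta> k \<bullet> v) \<le> M v"
    using bound by metis
  have "\<forall>\<^sub>F k in sequentially. \<forall>b\<in>Basis. - (\<eta> k \<bullet> b) \<le> M b \<and> - (\<eta> k \<bullet> (- b)) \<le> M (- b)"
    by (intro eventually_ball_finite ballI eventually_conj M) simp
  then have "\<forall>\<^sub>F k in sequentially. norm (\<eta> k) \<le> (\<Sum>b\<in>Basis. \<bar>M b\<bar> + \<bar>M (- b)\<bar>)"
  proof eventually_elim
    case (elim k)
    have "\<bar>\<eta> k \<bullet> b\<bar> \<le> \<bar>M b\<bar> + \<bar>M (- b)\<bar>" if "b \<in> Basis" for b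
      using elim that unfolding inner_minus_right by fastforce
    then show ?case by (intro order_trans[OF norm_le_l1] sum_mono)
  qed
  then have "bounded (range \<eta>)"
    unfolding Bseq_eq_bounded[symmetric] by (rule BfunI)
  then obtain \<eta>' r1 where r1: "strict_mono r1" and lim1: "(\<eta> \<circ> r1) \<longlonglongrightarrow> \<eta>'"
    using bounded_imp_convergent_subsequence by blast
  \<comment> \<open>A second extraction, along \<open>r1\<close>, makes the weights converge as
    well.\<close>
  have "bounded (range (\<lambda>k. w (r1 k) i))" if "i \<in> ?I" for i
    using w0 w1[OF that] by (intro boundedI[where B = 1]) auto
  from finite_family_convergent_subsequence[where a = "\<lambda>k. w (r1 k)", OF finI this]
  obtain r2 :: "nat \<Rightarrow> nat" and l where r2: "strict_mono r2"
    and lim2: "\<And>i. i \<in> ?I \<Longrightarrow> (\<lambda>k. w (r1 (r2 k)) i) \<longlonglongrightarrow> l i" by blast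
  define r where "r k = r1 (r2 k)" for k
  have r: "strict_mono r" using r1 r2 by (simp add: r_def strict_mono_def)
  have lim_w: "(\<lambda>k. w (r k) i) \<longlonglongrightarrow> l i" if "i \<in> ?I" for i
    using lim2[OF that] by (simp add: r_def)
  have lim_\<eta>: "(\<lambda>k. \<eta> (r k)) \<longlonglongrightarrow> \<eta>'"
    using LIMSEQ_subseq_LIMSEQ[OF lim1 r2] by (simp add: r_def o_def)
  have sub: "\<forall>\<^sub>F k in sequentially. P (r k)" if "\<forall>\<^sub>F k in sequentially. P k" for P
    using that r by (rule eventually_subseq[rotated])
  have y_r: "(\<lambda>k. y (r k)) \<longlonglongrightarrow> x" using LIMSEQ_subseq_LIMSEQ[OF y r] by (simp add: o_def)
  have z_r: "(\<lambda>k. z (r k)) \<longlonglongrightarrow> x" using LIMSEQ_subseq_LIMSEQ[OF z r] by (simp add: o_def)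

  have l0: "l i \<ge> 0" if "i \<in> ?I" for i
    using lim_w[OF that] w0 by (intro LIMSEQ_le_const) auto
  have "(\<lambda>k. \<Sum>i\<in>?I. w (r k) i) \<longlonglongrightarrow> sum l ?I"
    by (intro tendsto_sum lim_w)
  then have "(\<lambda>k. 1) \<longlonglongrightarrow> sum l ?I" by (simp only: wsum)
  then have l1: "sum l ?I = 1" by (simp add: LIMSEQ_const_iff)
  \<comment> \<open>The limiting cone asks for Frechet normals at every index, so the sequences are
    shifted past \<open>N\<close>.\<close>
  have normal: "\<eta>' \<in> limiting_normal_cone X x"
  proof -
    obtain N where N: "\<And>k. k \<ge> N \<Longrightarrow> \<eta> (r k) \<in> frechet_normal_cone X (z (r k))"
      using sub[OF ev_normal] unfolding eventually_sequentially by blast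
    show ?thesis
      unfolding limiting_normal_cone_def
      using zX N LIMSEQ_ignore_initial_segment[OF z_r, of N]
        LIMSEQ_ignore_initial_segment[OF lim_\<eta>, of N]
      by (intro CollectI exI[of _ "\<lambda>k. z (r (k + N))"] exI[of _ "\<lambda>k. \<eta> (r (k + N))"]) simp
  qed
  have stat: "0 \<le> (\<Sum>i\<in>?I. l i * dir_deriv (h i) x v) + \<eta>' \<bullet> v" for v
  proof (rule field_le_epsilon)
    fix d :: real assume "d > 0"
    have "(\<lambda>k. (\<Sum>i\<in>?I. w (r k) i * dir_deriv (h i) x v) + d
        + \<eta> (r k) \<bullet> v + 2 * norm (y (r k) - x) * norm v)
      \<longlonglongrightarrow> (\<Sum>i\<in>?I. l i * dir_deriv (h i) x v) + d + \<eta>' \<bullet> v + 2 * norm (x - x) * norm v"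
      by (intro tendsto_add tendsto_sum tendsto_mult tendsto_inner tendsto_norm tendsto_diff
          tendsto_const lim_w lim_\<eta> y_r)
    then have "0 \<le> (\<Sum>i\<in>?I. l i * dir_deriv (h i) x v) + d + \<eta>' \<bullet> v + 2 * norm (x - x) * norm v"
      using sub[OF ev_upper[OF \<open>d > 0\<close>, of v]] by (rule tendsto_lowerbound) simp
    then show "0 \<le> (\<Sum>i\<in>?I. l i * dir_deriv (h i) x v) + \<eta>' \<bullet> v + d" by simp
  qed
  \<comment> \<open>A positive limit makes \<open>w (r k) j\<close> eventually positive, which by
    the form of \<open>m\<close> forces \<open>h j\<close> to be positive there; finiteness of
    \<open>J\<close> gives a common starting index.\<close>
  have "\<forall>\<^sub>F k in sequentially. \<forall>j\<in>{j \<in> J. l j > 0}. h j (y (r k)) > 0"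
  proof (intro eventually_ball_finite ballI)
    fix j assume j: "j \<in> {j \<in> J. l j > 0}"
    have "\<forall>\<^sub>F k in sequentially. 0 < w (r k) j"
      using j by (intro order_tendstoD(1)[OF lim_w]) auto
    then show "\<forall>\<^sub>F k in sequentially. h j (y (r k)) > 0"
    proof eventually_elim
      case (elim k)
      moreover have "j \<noteq> i0" using i0 j by auto
      ultimately show ?case
        by (cases "h j (y (r k)) > 0") (simp_all add: w_def m_def max_absorb1)
    qed
  qed (simp add: fin)
  then obtain N where N: "\<And>k j. k \<ge> N \<Longrightarrow> j \<in> J \<Longrightarrow> l j > 0 \<Longrightarrow> h j (y (r k)) > 0"
    unfolding eventually_sequentially by blast
  show thesis
    using N by (intro that[of l \<eta>' "\<lambda>k. y (r (k + N))"] l0 l1 normal stat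
        LIMSEQ_ignore_initial_segment[OF y_r]) auto
qed

section \<open>From the Fritz John condition to the enhanced T-KKT condition\<close>

lemma locally_lipschitz_on_imp_continuous_on:
  assumes "locally_lipschitz_on U h"
  shows "continuous_on U h"
proof (rule continuous_at_imp_continuous_on, rule ballI)
  fix y assume "y \<in> U"
  from assms[unfolded locally_lipschitz_on_def, rule_format, OF this]
  obtain e L where "e > 0" and L: "L-lipschitz_on (ball y e) h"
    by (elim exE conjE)
  from lipschitz_on_continuous_on[OF L]
  have "\<forall>y'\<in>ball y e. isCont h y'"
    by (rule iffD1[OF continuous_on_eq_continuous_at[OF open_ball]])
  then show "isCont h y" by (rule bspec) (simp add: \<open>e > 0\<close>)
qed

theorem theorem12:
  fixes X :: "(real ^ 'n) set"
    and f :: "real ^ 'n \<Rightarrow> real"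
    and q :: nat
    and g :: "nat \<Rightarrow> real ^ 'n \<Rightarrow> real"
    and x :: "real ^ 'n"
  assumes "closed X"
    and "local_minimizer_on (feasible_set X q g) f x"
    and "\<exists>U. open U \<and> x \<in> U \<and>
           locally_lipschitz_on U f \<and> (\<forall>y\<in>U. tangentially_convex_at f y) \<and>
           (\<forall>j\<in>{1..q}. locally_lipschitz_on U (g j) \<and> (\<forall>y\<in>U. tangentially_convex_at (g j) y))"
    and "convex (contingent_cone X x)"
    and "clarke_regular_at f x"
    and "\<forall>j\<in>{1..q}. clarke_regular_at (g j) x"
    and "outer_semicontinuous_at (limiting_normal_cone X) x"
    and "T_quasinormal X q g x"
  shows "\<exists>(\<mu> :: nat \<Rightarrow> real) \<xi>\<^sub>f (\<xi> :: nat \<Rightarrow> real ^ 'n) \<eta>.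
           (\<forall>j\<in>{1..q}. \<mu> j \<ge> 0) \<and>
           \<xi>\<^sub>f \<in> tangential_subdiff f x \<and>
           (\<forall>j\<in>{1..q}. \<xi> j \<in> tangential_subdiff (g j) x) \<and>
           \<eta> \<in> limiting_normal_cone X x \<and>
           0 = \<xi>\<^sub>f + (\<Sum>j\<in>{1..q}. \<mu> j *\<^sub>R \<xi> j) + \<eta> \<and>
           (\<forall>j\<in>{1..q}. \<mu> j * g j x = 0)"
proof -
  \<comment> \<open>Constraints are numbered from 1, so index 0 is free for the objective.\<close>
  define h where "h = g(0 := f)"
  have h0: "h 0 = f" and hj: "\<And>j. j \<in> {1..q} \<Longrightarrow> h j = g j"
    by (simp_all add: h_def)
  have h_all: "P (h i)" if "P f" "\<forall>j\<in>{1..q}. P (g j)" "i \<in> insert 0 {1..q}" for P i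
    using that by (auto simp: h_def)
  have X: "x \<in> X" and feas: "\<And>j. j \<in> {1..q} \<Longrightarrow> g j x \<le> 0"
    using assms(2) by (auto simp: local_minimizer_on_def feasible_set_def)
  obtain d where d: "d > 0" "\<And>y. y \<in> feasible_set X q g \<Longrightarrow> y \<in> ball x d \<Longrightarrow> f x \<le> f y"
    using assms(2) unfolding local_minimizer_on_def by blast
  obtain U where U: "open U" "x \<in> U"
    and lip: "locally_lipschitz_on U f" "\<forall>j\<in>{1..q}. locally_lipschitz_on U (g j)"
    and tcU: "\<forall>y\<in>U. tangentially_convex_at f y" "\<forall>j\<in>{1..q}. \<forall>y\<in>U. tangentially_convex_at (g j) y"
    using assms(3) by blast
  obtain d' where d': "d' > 0" "cball x d' \<subseteq> U"
    using U open_contains_cball by blast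
  \<comment> \<open>Halving \<open>d\<close> fits the closed ball into the open ball of local
    minimality; \<open>d'\<close> keeps it inside \<open>U\<close>.\<close>
  define e where "e = min d' (d / 2)"
  have e: "e > 0" "cball x e \<subseteq> U" "cball x e \<subseteq> ball x d"
    using d(1) d' by (auto simp: e_def)
  have contU: "continuous_on U (h i)" if "i \<in> insert 0 {1..q}" for i
    using h_all[where P = "locally_lipschitz_on U", OF lip that] by (rule locally_lipschitz_on_imp_continuous_on)
  have tc: "tangentially_convex_at (h i) y" if "i \<in> insert 0 {1..q}" "y \<in> U" for i y
    using h_all[where P = "\<lambda>u. \<forall>y\<in>U. tangentially_convex_at u y", OF tcU that(1)] that(2) by (rule bspec)
  have reg: "clarke_regular_at (h i) x" if "i \<in> insert 0 {1..q}" for i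
    by (rule h_all[where P = "\<lambda>u. clarke_regular_at u x", OF assms(5,6) that])
  obtain l \<eta> y where l: "\<And>i. i \<in> insert 0 {1..q} \<Longrightarrow> 0 \<le> l i" "sum l (insert 0 {1..q}) = 1"
    and \<eta>: "\<eta> \<in> limiting_normal_cone X x"
    and stat: "\<And>v. 0 \<le> (\<Sum>i\<in>insert 0 {1..q}. l i * dir_deriv (h i) x v) + \<eta> \<bullet> v"
    and y: "y \<longlonglongrightarrow> x" "\<And>j k. j \<in> {1..q} \<Longrightarrow> l j > 0 \<Longrightarrow> h j (y k) > 0"
  proof (rule fritz_john[of X x e "{1..q}" 0 h])
    show "h 0 x \<le> h 0 y" if "y \<in> X \<inter> cball x e" "\<And>j. j \<in> {1..q} \<Longrightarrow> h j y \<le> 0" for y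
      unfolding h0 using that e(3) hj by (intro d(2)) (auto simp: feasible_set_def)
    show "\<forall>\<^sub>F y in nhds x. tangentially_convex_at (h i) y" if "i \<in> insert 0 {1..q}" for i
      using eventually_nhds_in_open[OF U] by eventually_elim (rule tc[OF that])
    show "continuous_on (cball x e) (h i)" if "i \<in> insert 0 {1..q}" for i
      using contU[OF that] e(2) by (rule continuous_on_subset)
  qed (use assms(1) X e(1) feas hj reg in auto)
  obtain \<xi> where \<xi>: "\<And>i. i \<in> insert 0 {1..q} \<Longrightarrow> \<xi> i \<in> tangential_subdiff (h i) x"
    and eq: "- \<eta> = (\<Sum>i\<in>insert 0 {1..q}. l i *\<^sub>R \<xi> i)"
  proof (rule tangential_subdiff_sum_rule[of "insert 0 {1..q}" h x "- \<eta>" l])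
    show "- \<eta> \<bullet> v \<le> (\<Sum>i\<in>insert 0 {1..q}. l i * dir_deriv (h i) x v)" for v
      using stat[of v] unfolding inner_minus_left by linarith
  qed (use tc U(2) in auto)
  have eq': "l 0 *\<^sub>R \<xi> 0 + (\<Sum>j\<in>{1..q}. l j *\<^sub>R \<xi> j) + \<eta> = 0"
    using eq by (simp add: eq_neg_iff_add_eq_0 minus_equation_iff neg_eq_iff_add_eq_0 add.commute)
  have \<xi>f: "\<xi> 0 \<in> tangential_subdiff f x"
    using \<xi>[of 0] by (simp add: h0)
  have \<xi>g: "\<xi> j \<in> tangential_subdiff (g j) x" if "j \<in> {1..q}" for j
    using \<xi>[of j] that by (simp add: hj)
  have active: "g j (y k) > 0" if "j \<in> {1..q}" "l j > 0" for j k
    using y(2)[OF that, of k] hj[OF that(1)] by simp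
  \<comment> \<open>If \<open>l 0\<close> vanished, some constraint would have positive weight, as
    the weights sum to 1. Then \<open>l\<close> and \<open>y\<close> would be the witnesses that
    T-quasinormality excludes, each \<open>y k\<close> being infeasible through that
    constraint.\<close>
  have "l 0 \<noteq> 0"
  proof
    assume l00: "l 0 = 0"
    have "\<exists>j\<in>{1..q}. l j \<noteq> 0"
    proof (rule ccontr)
      assume "\<not> (\<exists>j\<in>{1..q}. l j \<noteq> 0)"
      then have "sum l (insert 0 {1..q}) = 0" using l00 by (intro sum.neutral) auto
      with l(2) show False by simp
    qed
    then obtain j where j: "j \<in> {1..q}" "l j \<noteq> 0" by blast
    then have "l j > 0" using l(1)[of j] by simp
    have infeas: "\<forall>k. y k \<notin> feasible_set X q g"
    proof (intro allI notI)
      fix k assume "y k \<in> feasible_set X q g"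
      then have "g j (y k) \<le> 0" using j(1) by (simp add: feasible_set_def)
      with active[OF j(1) \<open>l j > 0\<close>, of k] show False by simp
    qed
    have pos: "\<forall>k. \<forall>j\<in>{j \<in> {1..q}. l j > 0}. l j * g j (y k) > 0"
    proof (intro allI ballI)
      fix k i assume "i \<in> {j \<in> {1..q}. l j > 0}"
      then show "l i * g i (y k) > 0" using active[of i k] by simp
    qed
    have zero: "0 \<in> (\<Sum>j\<in>{1..q}. (\<lambda>\<xi>. l j *\<^sub>R \<xi>) ` tangential_subdiff (g j) x)
        + limiting_normal_cone X x"
    proof -
      have "(\<Sum>j\<in>{1..q}. l j *\<^sub>R \<xi> j)
          \<in> (\<Sum>j\<in>{1..q}. (\<lambda>\<xi>. l j *\<^sub>R \<xi>) ` tangential_subdiff (g j) x)"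
        unfolding set_sum_alt[OF finite_atLeastAtMost] using \<xi>g by blast
      from set_plus_intro[OF this \<eta>] show ?thesis using eq' l00 by simp
    qed
    have nonneg: "\<forall>j\<in>{1..q}. l j \<ge> 0" using l(1) by simp
    have nonzero: "\<exists>j\<in>{1..q}. l j \<noteq> 0" using j by (rule bexI[rotated])
    show False
    proof (rule notE[OF conjunct2[OF assms(8)[unfolded T_quasinormal_def]]], rule exI[where x = l],
        rule conjI[OF nonneg], rule conjI[OF nonzero], rule conjI[OF zero], rule exI[where x = y])
      show "(\<forall>k. y k \<notin> feasible_set X q g) \<and> y \<longlonglongrightarrow> x \<and>
          (\<forall>k. \<forall>j\<in>{j \<in> {1..q}. l j > 0}. l j * g j (y k) > 0)"
        using infeas y(1) pos by (rule conjI[OF _ conjI])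
    qed
  qed
  then have l0: "l 0 > 0" using l(1)[of 0] by simp
  \<comment> \<open>For positive \<open>l j\<close>, continuity passes the sign of
    \<open>g j (y k)\<close> to a nonnegative limit \<open>g j x\<close>, and feasibility supplies
    the opposite inequality.\<close>
  have compl: "l j * g j x = 0" if j: "j \<in> {1..q}" for j
  proof (cases "l j = 0")
    case False
    then have "l j > 0" using l(1)[of j] j by simp
    have "isCont (g j) x"
      using contU[of j] j U hj[OF j] by (simp add: continuous_on_eq_continuous_at)
    then have "(\<lambda>k. g j (y k)) \<longlonglongrightarrow> g j x"
      using y(1) by (rule isCont_tendsto_compose)
    then have "0 \<le> g j x"
      using active[OF j \<open>l j > 0\<close>] by (intro LIMSEQ_le_const) (auto intro: less_imp_le)
    with feas[OF j] show ?thesis by simp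
  qed simp
  \<comment> \<open>Dividing by \<open>l 0\<close> normalises the multiplier of the objective to 1;
    the limiting normal cone absorbs the positive factor.\<close>
  have "0 = (1 / l 0) *\<^sub>R (l 0 *\<^sub>R \<xi> 0 + (\<Sum>j\<in>{1..q}. l j *\<^sub>R \<xi> j) + \<eta>)"
    using eq' by simp
  also have "\<dots> = \<xi> 0 + (\<Sum>j\<in>{1..q}. (l j / l 0) *\<^sub>R \<xi> j) + (1 / l 0) *\<^sub>R \<eta>"
    using l0 by (simp add: scaleR_right_distrib scaleR_sum_right)
  finally have sum0: "0 = \<xi> 0 + (\<Sum>j\<in>{1..q}. (l j / l 0) *\<^sub>R \<xi> j) + (1 / l 0) *\<^sub>R \<eta>" .
  show ?thesis
  proof (intro exI conjI ballI)
    show "0 = \<xi> 0 + (\<Sum>j\<in>{1..q}. (l j / l 0) *\<^sub>R \<xi> j) + (1 / l 0) *\<^sub>R \<eta>" by (fact sum0)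
    show "(1 / l 0) *\<^sub>R \<eta> \<in> limiting_normal_cone X x"
      using \<eta> l0 by (intro limiting_normal_cone_scaleR) auto
    show "\<xi> 0 \<in> tangential_subdiff f x" by (fact \<xi>f)
    show "\<xi> j \<in> tangential_subdiff (g j) x" if "j \<in> {1..q}" for j by (fact \<xi>g[OF that])
    show "l j / l 0 \<ge> 0" if "j \<in> {1..q}" for j
      using l(1)[of j] l0 that by simp
    show "l j / l 0 * g j x = 0" if "j \<in> {1..q}" for j
      using compl[OF that] by simp
  qed
qed

end
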